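(* Let $\lambda \neq 0$ be a real number and let $G$ be a cograph with vertex set $\{1,\ldots,n\}$. Then there is a matrix $M \in S(G)$ such that every eigenvalue of $M$ lies in $\{-\lambda,0,\lambda,2\lambda\}$ and every diagonal entry of $M$ belongs to $\{0,\lambda\}$.
   Context: A cograph is a finite simple graph containing no induced subgraph isomorphic to the path $P_4$ on four vertices. For a simple graph $G$ with vertex set $\{1,\ldots,n\}$ and edge set $E$, $S(G)$ denotes the set of real symmetric $n\times n$ matrices $M=(m_{ij})$ such that for all $i\neq j$, $m_{ij}\neq 0$ if and only if $\{i,j\}\in E$; the diagonal entries are unrestricted. *)

theory Defs
  imports
    "Jordan_Normal_Form.Char_Poly"
    "Graph_Theory.Graph_Theory"
begin

text \<open>
  A finite simple graph is a \<open>pair_graph\<close>: a finite loop-free symmetric digraph whose arcs are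
  pairs of vertices, the edge \<open>{u, v}\<close> being represented by the two arcs \<open>(u, v)\<close> and \<open>(v, u)\<close>.
\<close>

definition path4 :: "nat pair_pre_digraph" where
  "path4 = \<lparr>pverts = {1, 2, 3, 4},
            parcs = {(1, 2), (2, 1), (2, 3), (3, 2), (3, 4), (4, 3)}\<rparr>"

definition cograph :: "'a pair_pre_digraph \<Rightarrow> bool" where
  "cograph G \<longleftrightarrow> pair_graph G \<and>
     \<not> (\<exists>H :: 'a pair_pre_digraph.
          induced_subgraph (with_proj H) (with_proj G) \<and>
          digraph_iso (with_proj H) (with_proj path4))"

text \<open>
  \<open>sym_mats n G\<close> is the set \<open>S(G)\<close> for a graph \<open>G\<close> on \<open>{1..n}\<close>. Matrix indices start
  at \<open>0\<close>, so the entry at \<open>(i, j)\<close> belongs to the vertices \<open>Suc i\<close> and \<open>Suc j\<close>.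
\<close>

definition sym_mats :: "nat \<Rightarrow> nat pair_pre_digraph \<Rightarrow> real mat set" where
  "sym_mats n G = {M \<in> carrier_mat n n. transpose_mat M = M \<and>
     (\<forall>i<n. \<forall>j<n. i \<noteq> j \<longrightarrow> (M $$ (i, j) \<noteq> 0 \<longleftrightarrow> (Suc i, Suc j) \<in> parcs G))}"

lemma induced_path4_iff:
  assumes "pair_graph G"
  shows "(\<exists>H. induced_subgraph (with_proj H) (with_proj G) \<and>
              digraph_iso (with_proj H) (with_proj path4)) \<longleftrightarrow>
         (\<exists>a b c d. distinct [a, b, c, d] \<and> {a, b, c, d} \<subseteq> pverts G \<and>
            (a, b) \<in> parcs G \<and> (b, c) \<in> parcs G \<and> (c, d) \<in> parcs G \<and>
            (a, c) \<notin> parcs G \<and> (a, d) \<notin> parcs G \<and> (b, d) \<notin> parcs G)"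
    (is "?L \<longleftrightarrow> ?R")
proof -
  interpret pair_graph G by fact
  have sym: "(v, u) \<in> parcs G" if "(u, v) \<in> parcs G" for u v
    using that pair_sym_arcs by (auto simp: symmetric_def dest: symD)
  show ?thesis
  proof
    assume ?L
    then obtain H h where ind: "induced_subgraph (with_proj H) (with_proj G)"
      and iso: "pre_digraph.digraph_isomorphism (with_proj H) h"
      and app: "with_proj path4 = app_iso h (with_proj H)"
      unfolding digraph_iso_def by blast
    have sub: "pverts H \<subseteq> pverts G"
      and arcsH: "parcs H = {e \<in> parcs G. fst e \<in> pverts H \<and> snd e \<in> pverts H}"
      using ind by (auto simp: induced_subgraph_def subgraph_def)
    define f where "f = iso_verts h"
    have V: "f ` pverts H = {1, 2, 3, 4}"
      using arg_cong[OF app, of verts] by (simp add: f_def path4_def)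
    have A: "iso_arcs h ` parcs H = {(1, 2), (2, 1), (2, 3), (3, 2), (3, 4), (4, 3)}"
      using arg_cong[OF app, of arcs] by (simp add: path4_def)
    have T: "iso_tail h = fst" and Hd: "iso_head h = snd"
      using arg_cong[OF app, of tail] arg_cong[OF app, of head] by auto
    have inj: "inj_on f (pverts H)"
      using iso by (simp add: pre_digraph.digraph_isomorphism_def f_def)
    have ends: "iso_arcs h e = (f (fst e), f (snd e))" if "e \<in> parcs H" for e
      using iso that
      by (simp add: pre_digraph.digraph_isomorphism_def T Hd f_def prod_eq_iff)
    have E: "(u, v) \<in> parcs G \<longleftrightarrow>
        (f u, f v) \<in> {(1, 2), (2, 1), (2, 3), (3, 2), (3, 4), (4, 3)}"
      if uv: "u \<in> pverts H" "v \<in> pverts H" for u v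
    proof
      assume "(u, v) \<in> parcs G"
      then have "(u, v) \<in> parcs H" using uv by (simp add: arcsH)
      then show "(f u, f v) \<in> {(1, 2), (2, 1), (2, 3), (3, 2), (3, 4), (4, 3)}"
        using A ends[of "(u, v)"] by (metis fst_conv snd_conv image_eqI)
    next
      assume "(f u, f v) \<in> {(1, 2), (2, 1), (2, 3), (3, 2), (3, 4), (4, 3)}"
      then obtain e where e: "e \<in> parcs H" "iso_arcs h e = (f u, f v)"
        using A by (metis imageE)
      have "fst e \<in> pverts H" "snd e \<in> pverts H" using e(1) by (auto simp: arcsH)
      then have "fst e = u" "snd e = v"
        using e ends[OF e(1)] inj uv by (auto dest: inj_onD)
      then show "(u, v) \<in> parcs G" using e(1) by (auto simp: arcsH)
    qed
    have "\<exists>a\<in>pverts H. f a = 1" "\<exists>a\<in>pverts H. f a = 2"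
      "\<exists>a\<in>pverts H. f a = 3" "\<exists>a\<in>pverts H. f a = 4"
      using V by (metis imageE insertCI)+
    then obtain a b c d where "a \<in> pverts H" "f a = 1" "b \<in> pverts H" "f b = 2"
      "c \<in> pverts H" "f c = 3" "d \<in> pverts H" "f d = 4" by blast
    then show ?R
      using sub E by (intro exI[of _ a] exI[of _ b] exI[of _ c] exI[of _ d]) auto
  next
    assume ?R
    then obtain a b c d where dist: "distinct [a, b, c, d]"
      and V: "{a, b, c, d} \<subseteq> pverts G"
      and e: "(a, b) \<in> parcs G" "(b, c) \<in> parcs G" "(c, d) \<in> parcs G"
      and ne: "(a, c) \<notin> parcs G" "(a, d) \<notin> parcs G" "(b, d) \<notin> parcs G"
      by blast
    define H where "H = \<lparr>pverts = {a, b, c, d},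
      parcs = {(a, b), (b, a), (b, c), (c, b), (c, d), (d, c)}\<rparr>"
    have wfH: "wf_digraph (with_proj H)"
      by unfold_locales (auto simp: H_def)
    have loops: "(u, u) \<notin> parcs G" for u using pair_no_loops by fastforce
    have e': "(b, a) \<in> parcs G" "(c, b) \<in> parcs G" "(d, c) \<in> parcs G"
      "(c, a) \<notin> parcs G" "(d, a) \<notin> parcs G" "(d, b) \<notin> parcs G"
      using e ne by (blast intro: sym)+
    have neq: "a \<noteq> b" "a \<noteq> c" "a \<noteq> d" "b \<noteq> c" "b \<noteq> d" "c \<noteq> d"
      using dist by simp_all
    have "(u, v) \<in> parcs H \<longleftrightarrow> (u, v) \<in> parcs G"
      if "u \<in> {a, b, c, d}" "v \<in> {a, b, c, d}" for u v
      using that unfolding insert_iff empty_iff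
      by (elim disjE) (simp_all add: H_def e e' ne loops neq neq[symmetric])
    moreover have "(u, v) \<in> parcs H \<Longrightarrow> u \<in> {a, b, c, d} \<and> v \<in> {a, b, c, d}" for u v
      by (auto simp: H_def)
    moreover have "pverts H = {a, b, c, d}" by (simp add: H_def)
    ultimately have "(u, v) \<in> parcs H \<longleftrightarrow>
        (u, v) \<in> parcs G \<and> u \<in> pverts H \<and> v \<in> pverts H" for u v
      by metis
    then have "parcs H = {e \<in> parcs G. fst e \<in> pverts H \<and> snd e \<in> pverts H}"
      by auto
    moreover have "wf_digraph (with_proj G)" by unfold_locales
    ultimately have ind: "induced_subgraph (with_proj H) (with_proj G)"
      using V wfH by (auto simp: induced_subgraph_def subgraph_def H_def)
    define f :: "'a \<Rightarrow> nat" where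
      "f x = (if x = a then 1 else if x = b then 2 else if x = c then 3 else 4)" for x
    define h where "h = \<lparr>iso_verts = f, iso_arcs = map_prod f f,
      iso_head = snd, iso_tail = fst\<rparr>"
    have "pre_digraph.digraph_isomorphism (with_proj H) h"
      unfolding pre_digraph.digraph_isomorphism_def using wfH dist
      by (auto simp: h_def H_def f_def inj_on_def)
    moreover have "with_proj path4 = app_iso h (with_proj H)"
      by (simp add: app_iso_def with_proj_def path4_def h_def H_def f_def neq neq[symmetric]
        insert_commute)
    ultimately show ?L using ind unfolding digraph_iso_def by blast
  qed
qed

end

theory Submission
  imports Defs
begin

text \<open>
  Normalise \<open>lam = 1\<close>. A cograph with at least two vertices is a disjoint union or a join of two
  smaller cographs, so one can induct, proving the following stronger claim: for each
  \<open>s \<in> {0, 1}\<close> there is a suitable matrix having a nowhere-zero eigenvector for the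
  eigenvalue \<open>s\<close>. For a disjoint union take the direct sum of two matrices with the same \<open>s\<close>. For a
  join take matrices \<open>A\<close> and \<open>B\<close> with nowhere-zero unit eigenvectors \<open>u\<close> and \<open>v\<close> for \<open>s\<close>, and use
  the rank-one matrix \<open>u v\<^sup>T\<close> as off-diagonal block: all eigenvalues are inherited from \<open>A\<close> and \<open>B\<close>
  except \<open>s + 1\<close> and \<open>s - 1\<close>, whose eigenvectors \<open>(u, v)\<close> and \<open>(u, -v)\<close> are nowhere zero. Thus
  \<open>s = 0\<close> yields \<open>1\<close>, and \<open>s = 1\<close> yields \<open>0\<close>.
\<close>

section \<open>Decomposition of cographs\<close>

text \<open>Vertex set and relation are kept apart so that an induced subgraph only shrinks
  \<open>V\<close> and a complement only negates \<open>E\<close>. Loops, which the negation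
  creates, are invisible because of \<open>distinct\<close>.\<close>

definition P4_free :: "'a set \<Rightarrow> ('a \<Rightarrow> 'a \<Rightarrow> bool) \<Rightarrow> bool" where
  "P4_free V E \<longleftrightarrow> \<not> (\<exists>a\<in>V. \<exists>b\<in>V. \<exists>c\<in>V. \<exists>d\<in>V. distinct [a, b, c, d] \<and>
     E a b \<and> E b c \<and> E c d \<and> \<not> E a c \<and> \<not> E a d \<and> \<not> E b d)"

text \<open>For \<open>E\<close> this is a disconnection; for the negated relation it exhibits a
  join.\<close>

definition splits :: "'a set \<Rightarrow> ('a \<Rightarrow> 'a \<Rightarrow> bool) \<Rightarrow> 'a set \<Rightarrow> 'a set \<Rightarrow> bool" where
  "splits V E A B \<longleftrightarrow> A \<noteq> {} \<and> B \<noteq> {} \<and> A \<inter> B = {} \<and> A \<union> B = V \<and> (\<forall>a\<in>A. \<forall>b\<in>B. \<not> E a b)"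

lemma P4_free_mono: "P4_free V E \<Longrightarrow> W \<subseteq> V \<Longrightarrow> P4_free W E"
  unfolding P4_free_def by blast

lemma P4_free_complement:
  assumes "P4_free V E" and sym: "\<And>x y. E x y \<Longrightarrow> E y x"
  shows "P4_free V (\<lambda>x y. \<not> E x y)"
  unfolding P4_free_def
proof (safe)
  fix a b c d
  assume V: "a \<in> V" "b \<in> V" "c \<in> V" "d \<in> V" and "distinct [a, b, c, d]"
    and "\<not> E a b" "\<not> E b c" "\<not> E c d" "E a c" "E a d" "E b d"
  \<comment> \<open>The complement of the path \<open>a b c d\<close> is the path \<open>b d a c\<close>.\<close>
  then have "distinct [b, d, a, c] \<and> E b d \<and> E d a \<and> E a c \<and> \<not> E b a \<and> \<not> E b c \<and> \<not> E d c"
    using sym by auto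
  with V assms(1) show False unfolding P4_free_def by blast
qed

text \<open>If \<open>v\<close> misses some \<open>w\<close> in \<open>W\<close>, let
  \<open>C\<close> be the component of \<open>w\<close> in \<open>W\<close>. Either \<open>v\<close>
  has no neighbour in \<open>C\<close>, and \<open>C\<close> splits off, or P4-freeness forbids
  neighbours of \<open>v\<close> in \<open>W - C\<close>, and \<open>W - C\<close> splits
  off.\<close>

lemma split_insert:
  assumes P4: "P4_free (insert v W) E" and sym: "\<And>x y. E x y \<Longrightarrow> E y x"
    and v: "v \<notin> W" and split: "splits W E A B"
  shows "\<exists>C D. splits (insert v W) E C D \<or> splits (insert v W) (\<lambda>x y. \<not> E x y) C D"
proof (cases "\<forall>w\<in>W. E v w")
  case True
  then have "splits (insert v W) (\<lambda>x y. \<not> E x y) {v} W"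
    using v split by (auto simp: splits_def)
  then show ?thesis by blast
next
  case False
  then obtain w where w: "w \<in> W" "\<not> E v w" by blast
  define R where "R = {(x, y). x \<in> W \<and> y \<in> W \<and> E x y}"
  define C where "C = {y. (w, y) \<in> R\<^sup>*}"
  have wC: "w \<in> C" by (simp add: C_def)
  have closed: "y \<in> C" if "x \<in> C" "y \<in> W" "E x y" "x \<in> W" for x y
    using that by (auto simp: C_def R_def intro: rtrancl_into_rtrancl)
  have CW: "C \<subseteq> W"
  proof
    fix y assume "y \<in> C"
    then have "(w, y) \<in> R\<^sup>*" by (simp add: C_def)
    then show "y \<in> W" by induction (use w in \<open>auto simp: R_def\<close>)
  qed
  \<comment> \<open>A walk inside \<open>W\<close> cannot change sides between \<open>A\<close> and
    \<open>B\<close>, so \<open>C\<close> lies in one of them.\<close>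
  have "C \<noteq> W"
  proof -
    have "(y \<in> A) = (w \<in> A)" if "(w, y) \<in> R\<^sup>*" for y
      using that
    proof induction
      case (step y z)
      then have "E y z" "E z y" "y \<in> A \<union> B" "z \<in> A \<union> B"
        using split sym by (auto simp: R_def splits_def)
      with step.IH split show ?case unfolding splits_def by blast
    qed simp
    moreover obtain a b where "a \<in> A" "a \<in> W" "b \<notin> A" "b \<in> W"
      using split unfolding splits_def by blast
    ultimately show ?thesis unfolding C_def by blast
  qed
  show ?thesis
  proof (cases "\<exists>y\<in>C. E v y")
    case False
    have "splits (insert v W) E C (insert v W - C)"
      unfolding splits_def using wC CW v False sym closed by blast
    then show ?thesis by blast
  next
    case True
    then obtain y0 where "(w, y0) \<in> R\<^sup>*" "E v y0" by (auto simp: C_def)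
    \<comment> \<open>A walk in \<open>C\<close> from the non-neighbour \<open>w\<close> to the
      neighbour \<open>y0\<close> of \<open>v\<close> contains an edge where adjacency to
      \<open>v\<close> switches.\<close>
    then have "\<exists>x y. x \<in> C \<and> y \<in> C \<and> E x y \<and> E v y \<and> \<not> E v x"
    proof (induction)
      case base
      then show ?case using w by simp
    next
      case (step y z)
      show ?case
      proof (cases "E v y")
        case False
        moreover have "z \<in> C" "y \<in> C" "E y z"
          using step.hyps by (auto simp: C_def R_def intro: rtrancl_into_rtrancl)
        ultimately show ?thesis using step.prems by blast
      qed (use step.IH in blast)
    qed
    then obtain y x where yx: "y \<in> C" "x \<in> C" "E y x" "E v x" "\<not> E v y" by blast
    \<comment> \<open>Otherwise \<open>y\<close>, \<open>x\<close>, \<open>v\<close>,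
      \<open>z\<close> would be an induced P4.\<close>
    have no: "\<not> E v z" if z: "z \<in> W - C" for z
    proof
      assume "E v z"
      moreover have "\<not> E y z" "\<not> E x z" using closed yx CW z by blast+
      moreover have "distinct [y, x, v, z]" using yx z v CW by auto
      ultimately have "distinct [y, x, v, z] \<and> E y x \<and> E x v \<and> E v z \<and>
          \<not> E y v \<and> \<not> E y z \<and> \<not> E x z"
        using yx sym by blast
      moreover have "y \<in> insert v W" "x \<in> insert v W" "v \<in> insert v W" "z \<in> insert v W"
        using yx CW z by auto
      ultimately show False using P4 unfolding P4_free_def by blast
    qed
    have "splits (insert v W) E (insert v C) (W - C)"
      unfolding splits_def using \<open>C \<noteq> W\<close> CW v no closed by blast
    then show ?thesis by blast
  qed
qed

text \<open>Induction on vertices by \<open>split_insert\<close>. Since P4 is self-complementary, a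
  split of the complement of \<open>W\<close> is extended by applying that lemma to the
  complement.\<close>

lemma P4_free_splits:
  assumes "finite V" and "P4_free V E" and sym: "\<And>x y. E x y \<Longrightarrow> E y x" and "2 \<le> card V"
  shows "\<exists>A B. splits V E A B \<or> splits V (\<lambda>x y. \<not> E x y) A B"
  using assms(1,2,4)
proof (induction V rule: finite_induct)
  case (insert v W)
  show ?case
  proof (cases "2 \<le> card W")
    case True
    then obtain A B where "splits W E A B \<or> splits W (\<lambda>x y. \<not> E x y) A B"
      using insert P4_free_mono[of "insert v W" E W] by blast
    then show ?thesis
    proof
      assume "splits W E A B"
      then show ?thesis using split_insert[of v W E A B] insert sym by blast
    next
      assume co: "splits W (\<lambda>x y. \<not> E x y) A B"
      have "P4_free (insert v W) (\<lambda>x y. \<not> E x y)"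
        by (rule P4_free_complement[OF insert.prems(1) sym])
      moreover have "\<not> E y x" if "\<not> E x y" for x y
        using that sym by blast
      ultimately obtain C D where "splits (insert v W) (\<lambda>x y. \<not> E x y) C D \<or>
          splits (insert v W) (\<lambda>x y. \<not> \<not> E x y) C D"
        using split_insert[OF _ _ insert.hyps(2) co] by blast
      then show ?thesis unfolding not_not by blast
    qed
  next
    case False
    with insert have "card W = 1" by simp
    then obtain w where "W = {w}" by (auto simp: card_1_singleton_iff)
    then have "splits (insert v W) E {v} {w} \<or> splits (insert v W) (\<lambda>x y. \<not> E x y) {v} {w}"
      using insert by (auto simp: splits_def)
    then show ?thesis by blast
  qed
qed simp

section \<open>Realisations with a nowhere-zero eigenvector\<close>

text \<open>Matrices are functions on an arbitrary index set, so gluing needs no reindexing. The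
  last clause bounds the spectrum: every eigenvalue \<open>k\<close> of \<open>m\<close> on
  \<open>V\<close> is an allowed one.\<close>

definition realises ::
  "'a set \<Rightarrow> ('a \<Rightarrow> 'a \<Rightarrow> bool) \<Rightarrow> real \<Rightarrow> ('a \<Rightarrow> 'a \<Rightarrow> real) \<Rightarrow> ('a \<Rightarrow> real) \<Rightarrow> bool" where
  "realises V E s m u \<longleftrightarrow>
     (\<forall>i\<in>V. \<forall>j\<in>V. m i j = m j i) \<and>
     (\<forall>i\<in>V. \<forall>j\<in>V. i \<noteq> j \<longrightarrow> (m i j \<noteq> 0 \<longleftrightarrow> E i j)) \<and>
     (\<forall>i\<in>V. m i i \<in> {0, 1}) \<and>
     (\<forall>i\<in>V. u i \<noteq> 0 \<and> (\<Sum>j\<in>V. m i j * u j) = s * u i) \<and>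
     (\<forall>x k. (\<exists>i\<in>V. x i \<noteq> 0) \<longrightarrow> (\<forall>i\<in>V. (\<Sum>j\<in>V. m i j * x j) = k * x i) \<longrightarrow>
        k \<in> {-1, 0, 1, 2})"

lemma realises_normalise:
  assumes "realises V E s m u" "finite V" "V \<noteq> {}"
  obtains w where "realises V E s m w" "(\<Sum>i\<in>V. w i * w i) = 1"
proof -
  define c where "c = sqrt (\<Sum>i\<in>V. u i * u i)"
  have "0 < (\<Sum>i\<in>V. u i * u i)"
    using assms by (intro sum_pos) (auto simp: realises_def zero_less_mult_iff)
  then have c: "c > 0" "c * c = (\<Sum>i\<in>V. u i * u i)" by (auto simp: c_def)
  have "realises V E s m (\<lambda>i. u i / c)"
    using assms(1) c(1) by (auto simp: realises_def sum_divide_distrib[symmetric])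
  moreover have "(\<Sum>i\<in>V. (u i / c) * (u i / c)) = 1"
    using c \<open>0 < (\<Sum>i\<in>V. u i * u i)\<close> by (simp add: sum_divide_distrib[symmetric])
  ultimately show thesis using that by blast
qed

text \<open>By symmetry the matrix can be moved onto its eigenvector \<open>u\<close>. This turns an
  eigenvalue equation into a scalar one by pairing it with \<open>u\<close>.\<close>

lemma eigenvector_inner_product:
  fixes m :: "'a \<Rightarrow> 'a \<Rightarrow> real"
  assumes sym: "\<And>i j. i \<in> V \<Longrightarrow> j \<in> V \<Longrightarrow> m i j = m j i"
    and eig: "\<And>i. i \<in> V \<Longrightarrow> (\<Sum>j\<in>V. m i j * u j) = s * u i"
  shows "(\<Sum>i\<in>V. u i * (\<Sum>j\<in>V. m i j * x j)) = s * (\<Sum>i\<in>V. u i * x i)"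
proof -
  have "(\<Sum>i\<in>V. u i * (\<Sum>j\<in>V. m i j * x j)) = (\<Sum>i\<in>V. \<Sum>j\<in>V. u i * (m i j * x j))"
    by (simp add: sum_distrib_left)
  also have "\<dots> = (\<Sum>j\<in>V. \<Sum>i\<in>V. u i * (m i j * x j))"
    by (rule sum.swap)
  also have "\<dots> = (\<Sum>j\<in>V. (\<Sum>i\<in>V. m j i * u i) * x j)"
    by (auto simp: sum_distrib_right sym intro!: sum.cong)
  also have "\<dots> = (\<Sum>j\<in>V. s * (u j * x j))"
    by (intro sum.cong) (simp_all add: eig)
  finally show ?thesis by (simp add: sum_distrib_left)
qed

text \<open>The parameter \<open>t\<close> is \<open>0\<close> for a disjoint union and \<open>1\<close> for a join.\<close>

lemma realises_glue:
  assumes A: "realises A E s mA u" and B: "realises B E s mB v"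
    and uu: "(\<Sum>i\<in>A. u i * u i) = 1" and vv: "(\<Sum>i\<in>B. v i * v i) = 1"
    and fin: "finite A" "finite B" and disj: "A \<inter> B = {}"
    and s: "s \<in> {0, 1}" and t: "t \<in> {0, 1}" and e: "e \<in> {1, -1}"
    and cross: "\<And>a b. a \<in> A \<Longrightarrow> b \<in> B \<Longrightarrow> E a b \<longleftrightarrow> t = 1"
    and sym: "\<And>x y. E x y \<Longrightarrow> E y x"
  shows "\<exists>m w. realises (A \<union> B) E (s + e * t) m w"
proof -
  define m where "m i j = (if i \<in> A then if j \<in> A then mA i j else t * u i * v j
    else if j \<in> A then t * v i * u j else mB i j)" for i j
  define w where "w i = (if i \<in> A then u i else e * v i)" for i
  have Asym: "mA i j = mA j i" if "i \<in> A" "j \<in> A" for i j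
    using A that unfolding realises_def by blast
  have Bsym: "mB i j = mB j i" if "i \<in> B" "j \<in> B" for i j
    using B that unfolding realises_def by blast
  have Au: "u i \<noteq> 0" "(\<Sum>j\<in>A. mA i j * u j) = s * u i" if "i \<in> A" for i
    using A that unfolding realises_def by blast+
  have Bv: "v i \<noteq> 0" "(\<Sum>j\<in>B. mB i j * v j) = s * v i" if "i \<in> B" for i
    using B that unfolding realises_def by blast+
  have specA: "k \<in> {-1, 0, 1, 2}"
    if "\<exists>i\<in>A. x i \<noteq> 0" "\<forall>i\<in>A. (\<Sum>j\<in>A. mA i j * x j) = k * x i" for x k
    using A that unfolding realises_def by simp
  have specB: "k \<in> {-1, 0, 1, 2}"
    if "\<exists>i\<in>B. x i \<noteq> 0" "\<forall>i\<in>B. (\<Sum>j\<in>B. mB i j * x j) = k * x i" for x k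
    using B that unfolding realises_def by simp
  have nA: "i \<notin> A" if "i \<in> B" for i using that disj by blast
  have sumA: "(\<Sum>j\<in>A\<union>B. m i j * x j) = (\<Sum>j\<in>A. mA i j * x j) + t * u i * (\<Sum>j\<in>B. v j * x j)"
    if "i \<in> A" for i x
  proof -
    have "(\<Sum>j\<in>A\<union>B. m i j * x j) = (\<Sum>j\<in>A. m i j * x j) + (\<Sum>j\<in>B. m i j * x j)"
      by (rule sum.union_disjoint) (use fin disj in auto)
    also have "(\<Sum>j\<in>A. m i j * x j) = (\<Sum>j\<in>A. mA i j * x j)"
      using that by (auto simp: m_def intro!: sum.cong)
    also have "(\<Sum>j\<in>B. m i j * x j) = (\<Sum>j\<in>B. t * u i * (v j * x j))"
      using that nA by (auto simp: m_def intro!: sum.cong)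
    finally show ?thesis by (simp add: sum_distrib_left)
  qed
  have sumB: "(\<Sum>j\<in>A\<union>B. m i j * x j) = t * v i * (\<Sum>j\<in>A. u j * x j) + (\<Sum>j\<in>B. mB i j * x j)"
    if "i \<in> B" for i x
  proof -
    have "(\<Sum>j\<in>A\<union>B. m i j * x j) = (\<Sum>j\<in>A. m i j * x j) + (\<Sum>j\<in>B. m i j * x j)"
      by (rule sum.union_disjoint) (use fin disj in auto)
    also have "(\<Sum>j\<in>A. m i j * x j) = (\<Sum>j\<in>A. t * v i * (u j * x j))"
      using that nA by (auto simp: m_def intro!: sum.cong)
    also have "(\<Sum>j\<in>B. m i j * x j) = (\<Sum>j\<in>B. mB i j * x j)"
      using that nA by (auto simp: m_def intro!: sum.cong)
    finally show ?thesis by (simp add: sum_distrib_left)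
  qed
  have m_sym: "m i j = m j i" if "i \<in> A \<union> B" "j \<in> A \<union> B" for i j
    using that Asym Bsym by (auto simp: m_def)
  have m_graph: "m i j \<noteq> 0 \<longleftrightarrow> E i j" if ij: "i \<in> A \<union> B" "j \<in> A \<union> B" "i \<noteq> j" for i j
  proof -
    have 1: "mA i j \<noteq> 0 \<longleftrightarrow> E i j" if "i \<in> A" "j \<in> A"
      using A that ij(3) unfolding realises_def by blast
    have 2: "mB i j \<noteq> 0 \<longleftrightarrow> E i j" if "i \<in> B" "j \<in> B"
      using B that ij(3) unfolding realises_def by blast
    have 3: "t * u i * v j \<noteq> 0 \<longleftrightarrow> E i j" if "i \<in> A" "j \<in> B"
      using that cross t Au(1) Bv(1) by auto
    have 4: "t * v i * u j \<noteq> 0 \<longleftrightarrow> E i j" if "i \<in> B" "j \<in> A"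
      using that cross[of j i] sym t Au(1) Bv(1) by auto
    show ?thesis using ij 1 2 3 4 nA unfolding m_def by auto
  qed
  have m_diag: "m i i \<in> {0, 1}" if "i \<in> A \<union> B" for i
    using that A B unfolding m_def realises_def by auto
  \<comment> \<open>On \<open>A\<close> the cross block contributes \<open>t * e * u i\<close>, as
    \<open>v\<close> is a unit vector; on \<open>B\<close> it contributes \<open>t * v i\<close>,
    which is \<open>e * t * (e * v i)\<close> because \<open>e * e = 1\<close>.\<close>
  have m_eig: "w i \<noteq> 0 \<and> (\<Sum>j\<in>A\<union>B. m i j * w j) = (s + e * t) * w i" if "i \<in> A \<union> B" for i
  proof -
    have wA: "(\<Sum>j\<in>A. g j * w j) = (\<Sum>j\<in>A. g j * u j)" for g
      by (auto simp: w_def intro!: sum.cong)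
    have wB: "(\<Sum>j\<in>B. g j * w j) = e * (\<Sum>j\<in>B. g j * v j)" for g
      by (auto simp: w_def sum_distrib_left dest: nA intro!: sum.cong)
    have ee: "e * e = 1" using e by auto
    show ?thesis
    proof (cases "i \<in> A")
      case True
      then show ?thesis
        using Au[OF True] vv by (simp add: sumA wA wB) (simp add: w_def algebra_simps)
    next
      case False
      then have "i \<in> B" using that by blast
      moreover have "t * v i = e * t * (e * v i)" using ee by simp
      ultimately show ?thesis
        using Bv[OF \<open>i \<in> B\<close>] False uu e
        by (simp add: sumB wA wB) (auto simp: w_def algebra_simps)
    qed
  qed
  have m_spec: "k \<in> {-1, 0, 1, 2}"
    if nz: "\<exists>i\<in>A\<union>B. x i \<noteq> 0" and eig: "\<forall>i\<in>A\<union>B. (\<Sum>j\<in>A\<union>B. m i j * x j) = k * x i" for x k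
  proof -
    \<comment> \<open>The rank-one cross blocks see \<open>x\<close> only through these two inner
      products.\<close>
    define p where "p = (\<Sum>i\<in>A. u i * x i)"
    define q where "q = (\<Sum>i\<in>B. v i * x i)"
    have eA: "(\<Sum>j\<in>A. mA i j * x j) = k * x i - t * u i * q" if "i \<in> A" for i
      using eig that sumA[OF that, of x] by (simp add: q_def)
    have eB: "(\<Sum>j\<in>B. mB i j * x j) = k * x i - t * v i * p" if "i \<in> B" for i
      using eig that sumB[OF that, of x] by (simp add: p_def)
    \<comment> \<open>If the coupling vanishes, a nonzero restriction of \<open>x\<close> to
      \<open>A\<close> or \<open>B\<close> is an eigenvector of \<open>mA\<close> or
      \<open>mB\<close> for \<open>k\<close>.\<close>
    show ?thesis
    proof (cases "t * p = 0 \<and> t * q = 0")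
      case True
      then have "\<forall>i\<in>A. (\<Sum>j\<in>A. mA i j * x j) = k * x i"
        "\<forall>i\<in>B. (\<Sum>j\<in>B. mB i j * x j) = k * x i"
        using eA eB by auto
      moreover have "(\<exists>i\<in>A. x i \<noteq> 0) \<or> (\<exists>i\<in>B. x i \<noteq> 0)" using nz by blast
      ultimately show ?thesis using specA specB by blast
    next
      case False
      with t have t1: "t = 1" by auto
      \<comment> \<open>Pairing the equations on \<open>A\<close> and \<open>B\<close> with
        \<open>u\<close> and \<open>v\<close> yields \<open>q = (k - s) * p\<close> and
        \<open>p = (k - s) * q\<close>; a nonzero solution forces \<open>k = s + 1\<close> or
        \<open>k = s - 1\<close>, both allowed for \<open>s\<close> in
        \<open>{0, 1}\<close>.\<close>
      have "s * p = (\<Sum>i\<in>A. u i * (\<Sum>j\<in>A. mA i j * x j))"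
        unfolding p_def by (rule eigenvector_inner_product[symmetric]) (use Asym Au in auto)
      also have "\<dots> = (\<Sum>i\<in>A. k * (u i * x i) - q * (u i * u i))"
        by (rule sum.cong[OF refl], simp only: eA, simp add: t1 algebra_simps)
      also have "\<dots> = k * p - q"
        by (simp add: sum_subtractf sum_distrib_left[symmetric] uu p_def)
      finally have 1: "q = (k - s) * p" by (simp add: algebra_simps)
      have "s * q = (\<Sum>i\<in>B. v i * (\<Sum>j\<in>B. mB i j * x j))"
        unfolding q_def by (rule eigenvector_inner_product[symmetric]) (use Bsym Bv in auto)
      also have "\<dots> = (\<Sum>i\<in>B. k * (v i * x i) - p * (v i * v i))"
        by (rule sum.cong[OF refl], simp only: eB, simp add: t1 algebra_simps)
      also have "\<dots> = k * q - p"
        by (simp add: sum_subtractf sum_distrib_left[symmetric] vv q_def)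
      finally have 2: "p = (k - s) * q" by (simp add: algebra_simps)
      have "p \<noteq> 0" using False 1 by auto
      moreover have "(k - s) * ((k - s) * p) = p"
        by (simp only: 1[symmetric] 2[symmetric])
      then have "p * ((k - s)\<^sup>2 - 1) = 0"
        by (simp add: power2_eq_square algebra_simps)
      ultimately have "(k - s)\<^sup>2 = 1" by simp
      then have "k - s = 1 \<or> k - s = -1" by (simp add: power2_eq_1_iff)
      then show ?thesis using s by auto
    qed
  qed
  have "realises (A \<union> B) E (s + e * t) m w"
    unfolding realises_def
    using m_sym m_graph m_diag m_eig m_spec by blast
  then show ?thesis by blast
qed

lemma P4_free_realises:
  assumes "finite V" and "P4_free V E" and sym: "\<And>x y. E x y \<Longrightarrow> E y x" and "s \<in> {0, 1}"
  shows "\<exists>m u. realises V E s m u"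
  using assms(1,2,4)
proof (induction V arbitrary: s rule: finite_psubset_induct)
  case (psubset V)
  show ?case
  proof (cases "2 \<le> card V")
    case True
    then obtain A B where AB: "splits V E A B \<or> splits V (\<lambda>x y. \<not> E x y) A B"
      using P4_free_splits[of V E] psubset sym by blast
    then have sub: "A \<noteq> {}" "B \<noteq> {}" "A \<inter> B = {}" "A \<union> B = V" "A \<subset> V" "B \<subset> V"
      unfolding splits_def by blast+
    define t :: real where "t = (if splits V E A B then 0 else 1)"
    \<comment> \<open>A disjoint union keeps the eigenvalue \<open>s\<close>. A join needs parts for
      \<open>1 - s\<close>, and \<open>(1 - s) + e = s\<close> dictates the sign \<open>e\<close>.
      The induction hypothesis must therefore cover both values of \<open>s\<close>.\<close>
    define r where "r = (if splits V E A B then s else 1 - s)"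
    define e where "e = 2 * s - 1"
    have cross: "E a b \<longleftrightarrow> t = 1" if "a \<in> A" "b \<in> B" for a b
      using AB that by (auto simp: t_def splits_def)
    have fin: "finite A" "finite B" using psubset.hyps sub(4) by (auto intro: finite_subset)
    have r: "r \<in> {0, 1}" "e \<in> {1, -1}" "t \<in> {0, 1}"
      using psubset.prems by (auto simp: r_def e_def t_def)
    have "r + e * t = s" by (simp add: r_def e_def t_def)
    obtain mA u0 where "realises A E r mA u0"
      using psubset.IH[OF sub(5) P4_free_mono[OF psubset.prems(1)] r(1)] sub(5) by blast
    then obtain u where u: "realises A E r mA u" "(\<Sum>i\<in>A. u i * u i) = 1"
      using realises_normalise fin sub by metis
    obtain mB v0 where "realises B E r mB v0"
      using psubset.IH[OF sub(6) P4_free_mono[OF psubset.prems(1)] r(1)] sub(6) by blast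
    then obtain v where v: "realises B E r mB v" "(\<Sum>i\<in>B. v i * v i) = 1"
      using realises_normalise fin sub by metis
    have "\<exists>m w. realises (A \<union> B) E (r + e * t) m w"
      by (rule realises_glue[OF u(1) v(1) u(2) v(2) fin sub(3) r(1) r(3) r(2) cross sym])
    then show ?thesis using \<open>r + e * t = s\<close> sub(4) by simp
  next
    case False
    \<comment> \<open>A single vertex gets the 1-by-1 matrix with entry \<open>s\<close>; for empty
      \<open>V\<close> everything is vacuous.\<close>
    have "realises V E s (\<lambda>_ _. s) (\<lambda>_. 1)"
    proof (cases "V = {}")
      case True
      then show ?thesis by (simp add: realises_def)
    next
      case ne: False
      then have "card V = 1" using False psubset.hyps card_gt_0_iff[of V] by linarith
      then obtain v where "V = {v}" by (auto simp: card_1_singleton_iff)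
      then show ?thesis using psubset.prems by (auto simp: realises_def)
    qed
    then show ?thesis by blast
  qed
qed

section \<open>Passage to matrices and scaling by \<open>lam\<close>\<close>

theorem theorem3p1:
  fixes lam :: real and n :: nat and G :: "nat pair_pre_digraph"
  assumes "lam \<noteq> 0"
    and "cograph G"
    and "pverts G = {1..n}"
  shows "\<exists>M \<in> sym_mats n G.
           (\<forall>k. eigenvalue M k \<longrightarrow> k \<in> {- lam, 0, lam, 2 * lam}) \<and>
           (\<forall>i<n. M $$ (i, i) \<in> {0, lam})"
proof -
  interpret pair_graph G using assms(2) by (simp add: cograph_def)
  \<comment> \<open>\<open>E\<close> lives on the matrix indices \<open>{..<n}\<close>, hence the
    shift by \<open>Suc\<close>.\<close>
  define E where "E i j \<longleftrightarrow> (Suc i, Suc j) \<in> parcs G" for i j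
  have sym: "E y x" if "E x y" for x y
    using that pair_sym_arcs by (auto simp: E_def symmetric_def dest: symD)
  have no_P4: "\<not> (\<exists>a b c d. distinct [a, b, c, d] \<and> {a, b, c, d} \<subseteq> pverts G \<and>
            (a, b) \<in> parcs G \<and> (b, c) \<in> parcs G \<and> (c, d) \<in> parcs G \<and>
            (a, c) \<notin> parcs G \<and> (a, d) \<notin> parcs G \<and> (b, d) \<notin> parcs G)"
    using assms(2) induced_path4_iff[of G] unfolding cograph_def by blast
  have "P4_free {..<n} E"
    unfolding P4_free_def
  proof (safe)
    fix a b c d assume "a < n" "b < n" "c < n" "d < n" "distinct [a, b, c, d]"
      "E a b" "E b c" "E c d" "\<not> E a c" "\<not> E a d" "\<not> E b d"
    then have "distinct [Suc a, Suc b, Suc c, Suc d] \<and>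
        {Suc a, Suc b, Suc c, Suc d} \<subseteq> pverts G \<and>
        (Suc a, Suc b) \<in> parcs G \<and> (Suc b, Suc c) \<in> parcs G \<and> (Suc c, Suc d) \<in> parcs G \<and>
        (Suc a, Suc c) \<notin> parcs G \<and> (Suc a, Suc d) \<notin> parcs G \<and> (Suc b, Suc d) \<notin> parcs G"
      by (simp add: E_def assms(3))
    with no_P4 show False by blast
  qed
  then obtain m u where R: "realises {..<n} E 0 m u"
    using P4_free_realises[of "{..<n}" E 0] sym by blast
  \<comment> \<open>Scaling by the nonzero \<open>lam\<close> keeps the zero pattern and multiplies
    diagonal and spectrum by \<open>lam\<close>, so an eigenvalue \<open>k\<close> of
    \<open>M\<close> is compared with \<open>k / lam\<close> for \<open>m\<close>.\<close>
  define M where "M = mat n n (\<lambda>(i, j). lam * m i j)"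
  have "M \<in> sym_mats n G"
    using R assms(1) by (auto simp: sym_mats_def M_def realises_def E_def)
  moreover have "k \<in> {- lam, 0, lam, 2 * lam}" if "eigenvalue M k" for k
  proof -
    obtain x where x: "x \<in> carrier_vec n" "x \<noteq> 0\<^sub>v n" "M *\<^sub>v x = k \<cdot>\<^sub>v x"
      using \<open>eigenvalue M k\<close> by (auto simp: eigenvalue_def eigenvector_def M_def)
    have "\<exists>i\<in>{..<n}. x $ i \<noteq> 0"
    proof (rule ccontr)
      assume "\<not> ?thesis"
      then have "x = 0\<^sub>v n" using x(1) by (intro eq_vecI) auto
      with x(2) show False by simp
    qed
    moreover have "(\<Sum>j<n. m i j * x $ j) = k / lam * x $ i" if "i \<in> {..<n}" for i
    proof -
      have "(M *\<^sub>v x) $ i = (\<Sum>j<n. lam * m i j * x $ j)"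
        using that x(1) by (simp add: M_def scalar_prod_def lessThan_atLeast0)
      also have "\<dots> = lam * (\<Sum>j<n. m i j * x $ j)"
        by (simp add: sum_distrib_left mult.assoc)
      finally show ?thesis using that x assms(1) by (simp add: field_simps)
    qed
    ultimately have "k / lam \<in> {-1, 0, 1, 2}"
      using R unfolding realises_def by blast
    then show ?thesis using assms(1) by (auto simp: field_simps)
  qed
  moreover have "M $$ (i, i) \<in> {0, lam}" if "i < n" for i
    using R that by (auto simp: M_def realises_def)
  ultimately show ?thesis by blast
qed

end
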